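(* The following Cartesian products $K^{d_1+1}\times K^{d_2+1}$ of complete graphs are not $\lfloor (d_1+d_2+1)/2\rfloor$-linked: (i) $K^{2}\times K^{d_2+1}$ (that is, $d_1=1$) for every even integer $d_2\ge 1$; (ii) $K^{3}\times K^{d_2+1}$ (that is, $d_1=2$) for each $d_2\in\{1,3,5,7,9\}$.
   Context: $K^{t}$ denotes the complete graph on $t$ vertices. The Cartesian product $G_1\times G_2$ of two graphs is the graph whose vertices are the pairs $(v_1,v_2)$ with $v_i\in V(G_i)$, where $(u_1,u_2)$ and $(v_1,v_2)$ are adjacent if, for some $\ell\in\{1,2\}$, $u_\ell v_\ell\in E(G_\ell)$ and $u_i=v_i$ for $i\neq \ell$. For an integer $k\ge 0$, a graph $G$ is $k$-linked if it has at least $2k$ vertices and, for every set $X$ of exactly $2k$ distinct vertices of $G$ and every partition of $X$ into pairs $\{s_1,t_1\},\ldots,\{s_k,t_k\}$, there exist $k$ pairwise vertex-disjoint paths $L_1,\ldots,L_k$ in $G$ such that $L_i$ joins $s_i$ to $t_i$ for each $i\in\{1,\ldots,k\}$. *)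

theory Defs
  imports "Graph_Theory.Graph_Theory"
begin

text \<open>
  As in the imported library, a finite simple graph is a symmetric loop-free digraph
  without parallel arcs (locale \<open>pair_graph\<close>), and the complete graph on $n$ vertices is
  described up to isomorphism by the predicate \<open>complete_digraph n\<close>.
\<close>

definition cartesian_product ::
  "'a pair_pre_digraph \<Rightarrow> 'b pair_pre_digraph \<Rightarrow> ('a \<times> 'b) pair_pre_digraph" where
  "cartesian_product G\<^sub>1 G\<^sub>2 =
     \<lparr> pverts = pverts G\<^sub>1 \<times> pverts G\<^sub>2,
       parcs = {((u\<^sub>1, u\<^sub>2), (v\<^sub>1, v\<^sub>2)).
                  u\<^sub>1 \<in> pverts G\<^sub>1 \<and> u\<^sub>2 \<in> pverts G\<^sub>2 \<and> v\<^sub>1 \<in> pverts G\<^sub>1 \<and> v\<^sub>2 \<in> pverts G\<^sub>2 \<and>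
                  ((u\<^sub>1, v\<^sub>1) \<in> parcs G\<^sub>1 \<and> u\<^sub>2 = v\<^sub>2 \<or> (u\<^sub>2, v\<^sub>2) \<in> parcs G\<^sub>2 \<and> u\<^sub>1 = v\<^sub>1)} \<rparr>"

lemma pair_graph_cartesian_product:
  assumes "pair_graph G\<^sub>1" and "pair_graph G\<^sub>2"
  shows "pair_graph (cartesian_product G\<^sub>1 G\<^sub>2)"
proof -
  interpret G1: pair_graph G\<^sub>1 by fact
  interpret G2: pair_graph G\<^sub>2 by fact
  let ?P = "cartesian_product G\<^sub>1 G\<^sub>2"
  have "parcs ?P \<subseteq> pverts ?P \<times> pverts ?P" and "finite (pverts ?P)"
    by (auto simp: cartesian_product_def)
  then have "finite (parcs ?P)"
    by (meson finite_SigmaI finite_subset)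
  with \<open>finite (pverts ?P)\<close> show ?thesis
    using arcs_ends_symmetric[OF G1.pair_sym_arcs] arcs_ends_symmetric[OF G2.pair_sym_arcs]
      G1.pair_no_loops G2.pair_no_loops
    by unfold_locales (fastforce simp: cartesian_product_def symmetric_def intro!: symI)+
qed

text \<open>
  The partition of \<open>X\<close> into pairs is given by \<open>s\<close> and \<open>t\<close>: since \<open>X\<close> has exactly $2k$
  elements, the equation for \<open>X\<close> forces the $2k$ vertices \<open>s i\<close>, \<open>t i\<close> with \<open>i < k\<close> to be
  distinct. The notion is intended for finite graphs (\<open>card\<close> of an infinite set is 0).
\<close>
definition k_linked :: "nat \<Rightarrow> ('a, 'b) pre_digraph \<Rightarrow> bool" where
  "k_linked k G \<longleftrightarrow>
     2 * k \<le> card (verts G) \<and>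
     (\<forall>X s t. X \<subseteq> verts G \<and> card X = 2 * k \<and> X = (\<Union>i<k. {s i, t i}) \<longrightarrow>
        (\<exists>L :: nat \<Rightarrow> 'a vwalk.
           (\<forall>i<k. vpath (L i) G \<and> hd (L i) = s i \<and> last (L i) = t i) \<and>
           (\<forall>i<k. \<forall>j<k. i \<noteq> j \<longrightarrow> set (L i) \<inter> set (L j) = {})))"

end

(* Lay the product out as a grid with at most three rows, and choose terminal pairs whose ends lie
   in different rows. The path towards t enters the row of t along an edge inside some column, and
   this edge uses two vertices of that column; since a column has at most three vertices, different
   paths use different columns. A column is useless to a path if, for every way of entering the
   row of t in it, one of the two vertices is a terminal of another path. The terminals are placed
   so that the first q columns are useless to every path while fewer than k columns remain:
   most of these q columns are filled with terminals completely, and each of the others holds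
   exactly two, in rows r and r', both belonging to paths between rows r and r'. *)
theory Submission
  imports Defs
begin

text \<open>Rows are first coordinates, columns second. Adjacency is only bounded from above, which
  is the direction that matters when paths have to be excluded.\<close>

definition grid_layout ::
  "nat \<Rightarrow> nat \<Rightarrow> (nat \<times> nat \<Rightarrow> 'v) \<Rightarrow> ('v, 'e) pre_digraph \<Rightarrow> bool" where
  "grid_layout a n \<phi> G \<longleftrightarrow>
     bij_betw \<phi> ({..<a} \<times> {..<n}) (verts G) \<and>
     (\<forall>p \<in> {..<a} \<times> {..<n}. \<forall>q \<in> {..<a} \<times> {..<n}.
        (\<phi> p, \<phi> q) \<in> arcs_ends G \<longrightarrow> fst p = fst q \<or> snd p = snd q)"

text \<open>Follow the walk to its first vertex satisfying \<open>P\<close>; the arc into that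
  vertex is the one sought. It is applied with \<open>P\<close> as membership in the row of a
  target.\<close>

lemma vwalk_enters:
  assumes "vwalk p G" and "\<not> P (hd p)" and "P (last p)"
  obtains u v where "(u, v) \<in> arcs_ends G" and "u \<in> set p" and "v \<in> set p"
    and "\<not> P u" and "P v"
proof -
  have "\<exists>u v. (u, v) \<in> arcs_ends G \<and> u \<in> set p \<and> v \<in> set p \<and> \<not> P u \<and> P v"
    using assms
  proof (induction p)
    case (Base u)
    then show ?case by simp
  next
    case (Cons u v es)
    then show ?case by (cases "P v") auto
  qed
  with that show thesis by blast
qed

text \<open>Pigeonhole on columns: each path enters its target row in one of the
  \<open>n - q\<close> columns that are not blocked, distinct paths do so in distinct columns, and
  \<open>few\<close> says \<open>n - q < k\<close>.\<close>

lemma not_k_linked_grid: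
  fixes G :: "('v, 'e) pre_digraph"
  assumes layout: "grid_layout a n \<phi> G" and "a \<le> 3"
    and len: "length S = k" "length T = k"
    and dist: "distinct (S @ T)" and sub: "set (S @ T) \<subseteq> {..<a} \<times> {..<n}"
    and rows: "\<forall>i<k. fst (S ! i) \<noteq> fst (T ! i)"
    and blocked: "\<forall>i<k. \<forall>m<q. \<forall>x<a. x \<noteq> fst (T ! i) \<longrightarrow>
      (\<exists>j<k. j \<noteq> i \<and> ((x, m) \<in> {S ! j, T ! j} \<or> (fst (T ! i), m) \<in> {S ! j, T ! j}))"
    and few: "n < q + k" and "q \<le> n"
  shows "\<not> k_linked k G"
proof
  assume linked: "k_linked k G"
  let ?D = "{..<a} \<times> {..<n}"
  let ?\<psi> = "inv_into ?D \<phi>"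
  have inj: "inj_on \<phi> ?D" and img: "\<phi> ` ?D = verts G"
    using layout by (auto simp: grid_layout_def bij_betw_def)
  define X where "X = \<phi> ` set (S @ T)"
  have "card X = 2 * k"
    using card_image[OF inj_on_subset[OF inj sub]] distinct_card[OF dist] len
    by (simp add: X_def)
  moreover have "X = (\<Union>i<k. {\<phi> (S ! i), \<phi> (T ! i)})"
    unfolding X_def set_append set_conv_nth[of S] set_conv_nth[of T] using len by auto
  moreover have "X \<subseteq> verts G"
    using sub img by (auto simp: X_def)
  ultimately have "X \<subseteq> verts G \<and> card X = 2 * k \<and> X = (\<Union>i<k. {\<phi> (S ! i), \<phi> (T ! i)})"
    by (intro conjI)
  from linked[unfolded k_linked_def, THEN conjunct2, THEN spec, THEN spec, THEN spec, THEN mp,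
      OF this]
  obtain L where L: "\<forall>i<k. vpath (L i) G \<and> hd (L i) = \<phi> (S ! i) \<and> last (L i) = \<phi> (T ! i)"
      "\<forall>i<k. \<forall>j<k. i \<noteq> j \<longrightarrow> set (L i) \<inter> set (L j) = {}"
    by (elim exE conjE)
  have path: "vpath (L i) G" and ends: "hd (L i) = \<phi> (S ! i)" "last (L i) = \<phi> (T ! i)"
    if "i < k" for i
    using L(1) that by simp_all
  have disj: "set (L i) \<inter> set (L j) = {}" if "i < k" "j < k" "i \<noteq> j" for i j
    using L(2) that by simp
  have term_in: "\<phi> (S ! i) \<in> set (L i)" "\<phi> (T ! i) \<in> set (L i)" if "i < k" for i
  proof -
    have "L i \<noteq> []"
      using path[OF that] by (auto simp: vpath_def vwalk_def)
    then show "\<phi> (S ! i) \<in> set (L i)" "\<phi> (T ! i) \<in> set (L i)"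
      using hd_in_set last_in_set ends[OF that] by metis+
  qed
  have crossing: "\<exists>m x. q \<le> m \<and> m < n \<and> x < a \<and> x \<noteq> fst (T ! i) \<and> fst (T ! i) < a \<and>
      \<phi> (x, m) \<in> set (L i) \<and> \<phi> (fst (T ! i), m) \<in> set (L i)" if i: "i < k" for i
  proof -
    let ?r = "fst (T ! i)"
    have D: "S ! i \<in> ?D" "T ! i \<in> ?D"
      using sub len i nth_mem[of i S] nth_mem[of i T] by (auto simp del: nth_mem)
    obtain u v where uv: "(u, v) \<in> arcs_ends G" "u \<in> set (L i)" "v \<in> set (L i)"
        "fst (?\<psi> u) \<noteq> ?r" "fst (?\<psi> v) = ?r"
    proof (rule vwalk_enters[of "L i" G "\<lambda>w. fst (?\<psi> w) = ?r"])
      show "vwalk (L i) G"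
        using path[OF i] by (simp add: vpath_def)
    qed (use rows i in \<open>simp_all add: ends inv_into_f_f[OF inj] D\<close>)
    have "u \<in> \<phi> ` ?D" "v \<in> \<phi> ` ?D"
      using path[OF i] uv unfolding img by (auto simp: vpath_def vwalk_def)
    then have preim: "\<phi> (?\<psi> u) = u" "\<phi> (?\<psi> v) = v" "?\<psi> u \<in> ?D" "?\<psi> v \<in> ?D"
      by (auto intro: f_inv_into_f inv_into_into)
    moreover obtain x m where u: "?\<psi> u = (x, m)" by fastforce
    \<comment> \<open>The arc changes rows, so by the layout it stays within one column.\<close>
    moreover have "snd (?\<psi> u) = snd (?\<psi> v)"
      using layout preim uv unfolding grid_layout_def by metis
    ultimately have xm: "x < a" "m < n" "x \<noteq> ?r" "?r < a"
        "\<phi> (x, m) \<in> set (L i)" "\<phi> (?r, m) \<in> set (L i)"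
      using uv by (auto simp: mem_Times_iff) (metis prod.collapse)
    \<comment> \<open>In a blocked column one end of this arc would be a terminal of another path,
      against disjointness.\<close>
    have "q \<le> m"
    proof (rule ccontr)
      assume "\<not> q \<le> m"
      then obtain j where "j < k" "j \<noteq> i"
          and "(x, m) \<in> {S ! j, T ! j} \<or> (?r, m) \<in> {S ! j, T ! j}"
        using blocked i xm by (meson not_le)
      then have "\<phi> (x, m) \<in> set (L j) \<or> \<phi> (?r, m) \<in> set (L j)"
        using term_in[of j] by auto
      then show False
        using xm disj[OF i \<open>j < k\<close>] \<open>j \<noteq> i\<close> by auto
    qed
    with xm show ?thesis by blast
  qed
  then obtain m x where mx: "\<And>i. i < k \<Longrightarrow> q \<le> m i \<and> m i < n \<and> x i < a \<and> x i \<noteq> fst (T ! i) \<and>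
      fst (T ! i) < a \<and> \<phi> (x i, m i) \<in> set (L i) \<and> \<phi> (fst (T ! i), m i) \<in> set (L i)"
    by metis
  have "inj_on m {..<k}"
  proof (rule inj_onI, rule ccontr)
    fix i j assume ij: "i \<in> {..<k}" "j \<in> {..<k}" "m i = m j" "i \<noteq> j"
    \<comment> \<open>Two disjoint paths crossing in the same column would need four different rows,
      but \<open>a \<le> 3\<close>.\<close>
    then have "x i \<noteq> x j" "x i \<noteq> fst (T ! j)" "fst (T ! i) \<noteq> x j" "fst (T ! i) \<noteq> fst (T ! j)"
      using mx[of i] mx[of j] disj[of i j] by auto
    with mx[of i] mx[of j] ij \<open>a \<le> 3\<close> show False by simp
  qed
  moreover have "m ` {..<k} \<subseteq> {q..<n}"
    using mx by auto
  ultimately have "k \<le> n - q"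
    using card_inj_on_le[of m "{..<k}" "{q..<n}"] by simp
  with few \<open>q \<le> n\<close> show False by simp
qed

text \<open>Fill the first \<open>k\<close> columns with terminals, the targets being the sources
  shifted cyclically by one. As \<open>2 \<le> k\<close>, the shift has no fixed point, so each of
  these columns meets two different pairs and is blocked for every path. Only \<open>k - 1\<close>
  columns remain.\<close>

lemma not_k_linked_two_rows:
  assumes layout: "grid_layout 2 (2 * k - 1) \<phi> G" and "2 \<le> k"
  shows "\<not> k_linked k G"
proof (rule not_k_linked_grid[OF layout, where q = k
      and S = "map (\<lambda>i. (0, i)) [0..<k]" and T = "map (\<lambda>i. (1, Suc i mod k)) [0..<k]"])
  let ?S = "map (\<lambda>i. (0::nat, i)) [0..<k]" and ?T = "map (\<lambda>i. (1::nat, Suc i mod k)) [0..<k]"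
  have inj: "inj_on (\<lambda>i. Suc i mod k) {0..<k}"
    by (auto simp: inj_on_def mod_Suc split: if_splits)
  show "distinct (?S @ ?T)"
    by (auto simp: distinct_map inj_on_def dest: inj_onD[OF inj])
  show "set (?S @ ?T) \<subseteq> {..<2} \<times> {..<2 * k - 1}"
  proof -
    have "Suc i mod k < 2 * k - 1" for i
      using mod_less_divisor[of k "Suc i"] \<open>2 \<le> k\<close> by linarith
    then show ?thesis
      using \<open>2 \<le> k\<close> by auto
  qed
  show "\<forall>i<k. \<forall>m<k. \<forall>x<2. x \<noteq> fst (?T ! i) \<longrightarrow>
      (\<exists>j<k. j \<noteq> i \<and> ((x, m) \<in> {?S ! j, ?T ! j} \<or> (fst (?T ! i), m) \<in> {?S ! j, ?T ! j}))"
  proof (intro allI impI)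
    fix i m x :: nat
    assume *: "i < k" "m < k" "x < 2" "x \<noteq> fst (?T ! i)"
    then have "x = 0" by simp
    \<comment> \<open>\<open>l\<close> is the cyclic predecessor of \<open>m\<close>: column
      \<open>m\<close> holds the source of pair \<open>m\<close> and the target of pair
      \<open>l\<close>, and at least one of these pairs is not \<open>i\<close>.\<close>
    define l where "l = (if m = 0 then k - 1 else m - 1)"
    have "l < k" "l \<noteq> m" "Suc l mod k = m"
      using \<open>m < k\<close> \<open>2 \<le> k\<close> by (auto simp: l_def)
    then show "\<exists>j<k. j \<noteq> i \<and> ((x, m) \<in> {?S ! j, ?T ! j} \<or> (fst (?T ! i), m) \<in> {?S ! j, ?T ! j})"
      using * \<open>x = 0\<close> by (intro exI[of _ "if i = m then l else m"]) simp
  qed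
qed (use assms(2) in auto)

lemma ex_bij_complete_digraph:
  assumes "complete_digraph n (with_proj G)"
  obtains f where "bij_betw f {..<n} (pverts G)"
  using assms ex_bij_betw_nat_finite[of "pverts G"]
  by (auto simp: complete_digraph_pair_def atLeast0LessThan)

lemma arcs_cartesian_product_complete:
  assumes "complete_digraph a (with_proj G\<^sub>1)" and "complete_digraph n (with_proj G\<^sub>2)"
    and "((u\<^sub>1, u\<^sub>2), (v\<^sub>1, v\<^sub>2)) \<in> parcs (cartesian_product G\<^sub>1 G\<^sub>2)"
  shows "u\<^sub>1 = v\<^sub>1 \<or> u\<^sub>2 = v\<^sub>2"
  using assms by (auto simp: cartesian_product_def)

text \<open>Number the vertices of both factors; each arc of the product fixes one
  coordinate.\<close>

lemma grid_layout_cartesian_product: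
  assumes "complete_digraph a (with_proj G\<^sub>1)" and "complete_digraph n (with_proj G\<^sub>2)"
  obtains \<phi> where "grid_layout a n \<phi> (with_proj (cartesian_product G\<^sub>1 G\<^sub>2))"
proof -
  obtain f g where f: "bij_betw f {..<a} (pverts G\<^sub>1)" and g: "bij_betw g {..<n} (pverts G\<^sub>2)"
    using ex_bij_complete_digraph assms by metis
  have "grid_layout a n (map_prod f g) (with_proj (cartesian_product G\<^sub>1 G\<^sub>2))"
    unfolding grid_layout_def
  proof (intro conjI ballI impI)
    show "bij_betw (map_prod f g) ({..<a} \<times> {..<n}) (verts (with_proj (cartesian_product G\<^sub>1 G\<^sub>2)))"
      using bij_betw_map_prod[OF f g] by (simp add: cartesian_product_def)
  next
    fix p q
    assume "p \<in> {..<a} \<times> {..<n}" "q \<in> {..<a} \<times> {..<n}"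
      and "(map_prod f g p, map_prod f g q) \<in> arcs_ends (with_proj (cartesian_product G\<^sub>1 G\<^sub>2))"
    then show "fst p = fst q \<or> snd p = snd q"
      using arcs_cartesian_product_complete[OF assms, of "f (fst p)" "g (snd p)" "f (fst q)" "g (snd q)"]
        bij_betw_imp_inj_on[OF f] bij_betw_imp_inj_on[OF g]
      by (auto simp: map_prod_def split_beta inj_on_eq_iff)
  qed
  with that show thesis by blast
qed

lemma grid_layout_swap:
  assumes "grid_layout a n \<phi> G"
  shows "grid_layout n a (\<phi> \<circ> prod.swap) G"
proof -
  have "bij_betw prod.swap ({..<n} \<times> {..<a}) ({..<a} \<times> {..<n})"
    by (auto simp: bij_betw_def product_swap)
  then show ?thesis
    using assms unfolding grid_layout_def
    by (auto intro: bij_betw_trans)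
qed

text \<open>For \<open>d > 1\<close> there are \<open>2 * k - 2\<close> columns, of which
  \<open>q = k - 1\<close> are blocked, leaving \<open>k - 1\<close>. Columns 0 and 1 are full, each
  with terminals of three different pairs; the other \<open>k - 3\<close> blocked columns hold two
  terminals each. The latter suffice because any two of three rows meet the two occupied ones, and a
  path owning one of the two terminals has its target row occupied by the other.\<close>

lemma not_k_linked_three_rows:
  assumes layout: "grid_layout 3 (d + 1) \<phi> G" and "d \<in> {1, 3, 5, 7, 9}"
  shows "\<not> k_linked ((d + 3) div 2) G"
proof -
  consider "d = 1" | "d = 3" | "d = 5" | "d = 7" | "d = 9"
    using assms(2) by blast
  then show ?thesis
  proof cases
    \<comment> \<open>After transposition this is a grid with two rows and \<open>2 * 2 - 1\<close>
      columns.\<close>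
    case 1
    then have "d + 1 = 2" "2 * 2 - 1 = (3::nat)" "(d + 3) div 2 = 2"
      by simp_all
    then show ?thesis
      using not_k_linked_two_rows[of 2 "\<phi> \<circ> prod.swap" G] grid_layout_swap[OF layout]
      by (metis order_refl)
  next
    case 2
    have "\<not> k_linked 3 G"
      by (rule not_k_linked_grid[OF layout[unfolded 2], where q = 2
            and S = "[(0,0),(1,0),(2,0)]" and T = "[(1,1),(2,1),(0,1)]"])
        (simp_all add: All_less_Suc Ex_less_Suc numeral_eq_Suc)
    with 2 show ?thesis by simp
  next
    case 3
    have "\<not> k_linked 4 G"
      by (rule not_k_linked_grid[OF layout[unfolded 3], where q = 3
            and S = "[(0,2),(1,2),(0,0),(2,0)]" and T = "[(1,0),(0,1),(2,1),(1,1)]"])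
        (simp_all add: All_less_Suc Ex_less_Suc numeral_eq_Suc)
    with 3 show ?thesis by simp
  next
    case 4
    have "\<not> k_linked 5 G"
      by (rule not_k_linked_grid[OF layout[unfolded 4], where q = 4
            and S = "[(0,2),(1,2),(1,3),(2,3),(0,0)]" and T = "[(1,0),(0,1),(2,0),(1,1),(2,1)]"])
        (simp_all add: All_less_Suc Ex_less_Suc numeral_eq_Suc)
    with 4 show ?thesis by simp
  next
    \<comment> \<open>The three columns with two terminals use each pair of rows once, and all their
      partners lie in columns 0 and 1.\<close>
    case 5
    have "\<not> k_linked 6 G"
      by (rule not_k_linked_grid[OF layout[unfolded 5], where q = 5
            and S = "[(0,2),(1,2),(1,3),(2,3),(2,4),(0,4)]"
            and T = "[(1,0),(0,0),(2,0),(1,1),(0,1),(2,1)]"])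
        (simp_all add: All_less_Suc Ex_less_Suc numeral_eq_Suc)
    with 5 show ?thesis by simp
  qed
qed

theorem mainTheorem2:
  fixes G\<^sub>1 :: "'a pair_pre_digraph" and G\<^sub>2 :: "'b pair_pre_digraph"
  shows
    "(\<forall>d\<^sub>2::nat. d\<^sub>2 \<ge> 1 \<and> even d\<^sub>2 \<and>
        complete_digraph 2 (with_proj G\<^sub>1) \<and> complete_digraph (d\<^sub>2 + 1) (with_proj G\<^sub>2) \<longrightarrow>
        \<not> k_linked ((1 + d\<^sub>2 + 1) div 2) (with_proj (cartesian_product G\<^sub>1 G\<^sub>2))) \<and>
     (\<forall>d\<^sub>2\<in>{1, 3, 5, 7, 9::nat}.
        complete_digraph 3 (with_proj G\<^sub>1) \<and> complete_digraph (d\<^sub>2 + 1) (with_proj G\<^sub>2) \<longrightarrow>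
        \<not> k_linked ((2 + d\<^sub>2 + 1) div 2) (with_proj (cartesian_product G\<^sub>1 G\<^sub>2)))"
proof (intro conjI allI ballI impI; (elim conjE)?)
  fix d\<^sub>2 :: nat
  assume "d\<^sub>2 \<ge> 1" "even d\<^sub>2"
    and "complete_digraph 2 (with_proj G\<^sub>1)" "complete_digraph (d\<^sub>2 + 1) (with_proj G\<^sub>2)"
  then obtain \<phi> where "grid_layout 2 (d\<^sub>2 + 1) \<phi> (with_proj (cartesian_product G\<^sub>1 G\<^sub>2))"
    using grid_layout_cartesian_product by blast
  \<comment> \<open>Evenness makes the division exact, so the column count is precisely
    \<open>2 * k - 1\<close>; a positive even number is at least 2, whence
    \<open>2 \<le> k\<close>.\<close>
  moreover have "2 * ((1 + d\<^sub>2 + 1) div 2) - 1 = d\<^sub>2 + 1" "2 \<le> (1 + d\<^sub>2 + 1) div 2"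
    using \<open>d\<^sub>2 \<ge> 1\<close> \<open>even d\<^sub>2\<close> by (auto elim!: evenE)
  ultimately show "\<not> k_linked ((1 + d\<^sub>2 + 1) div 2) (with_proj (cartesian_product G\<^sub>1 G\<^sub>2))"
    by (metis not_k_linked_two_rows)
next
  fix d\<^sub>2 :: nat
  assume d: "d\<^sub>2 \<in> {1, 3, 5, 7, 9}"
    and "complete_digraph 3 (with_proj G\<^sub>1)" "complete_digraph (d\<^sub>2 + 1) (with_proj G\<^sub>2)"
  then obtain \<phi> where "grid_layout 3 (d\<^sub>2 + 1) \<phi> (with_proj (cartesian_product G\<^sub>1 G\<^sub>2))"
    using grid_layout_cartesian_product by blast
  moreover have "(2 + d\<^sub>2 + 1) div 2 = (d\<^sub>2 + 3) div 2"
    by (rule arg_cong[of _ _ "\<lambda>m. m div 2"]) simp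
  ultimately show "\<not> k_linked ((2 + d\<^sub>2 + 1) div 2) (with_proj (cartesian_product G\<^sub>1 G\<^sub>2))"
    using not_k_linked_three_rows d by metis
qed

end
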